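(* Let $n$ be a positive integer and $L$ a skew $(p,q)$-leaper with $p<q$. Then the leaper graph of $L$ over the pinwheel board $W_n(L)$ is trivial (it contains no nontrivial cycle) and the direction graph extracted from it depends only on $n$ (and not on $L$). Denote this direction graph by $W_n$, the pinwheel direction graph of order $n$. (This continues to apply to non-skew $(p,q)$-leapers $L$ with $p<q$ in the sense that the leaper graph of $L$ over $W_n(L)$ is an $L$-instantiation of $W_n$.) The pinwheel direction graph $W_n$ is a dual direction graph of complement $\pi_{\mathrm{Pinwheel}}(W_n)$ when $n$ is odd, and $\pi_{\mathrm{Reflect}}\circ\pi_{\mathrm{Pinwheel}}(W_n)$ when $n$ is even, and duality matrix $A^{\mathrm{Pinwheel}}_n=\begin{pmatrix}0&1\\1&2n\end{pmatrix}$, where $\pi_{\mathrm{Pinwheel}}$ is the permutation of the eight skew directions sending $1,2,3,4,5,6,7,8$ to $3,8,5,2,7,4,1,6$ respectively (an equivalence permutation, induced by the unit $2\times2$ matrix and $\begin{pmatrix}0&1\\-1&0\end{pmatrix}$), and $\pi_{\mathrm{Reflect}}(i)=9-i$.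
   Context: A square is a unit square of the infinite chessboard; a board is a set of squares. For nonnegative integers $p,q$, not both zero, a $(p,q)$-leaper is a piece that moves from a square $a$ to any of $a+(\pm p,\pm q)$, $a+(\pm q,\pm p)$; it is skew if $p,q$ are nonzero and distinct. The leaper graph of $L$ over a board $B$ has the squares of $B$ as vertices, two being adjacent when a move of $L$ joins them. Pinwheel boards. Given a $(p,q)$-leaper $L$ with $q\ne0$, use Cartesian coordinates with origin $O$ over the infinite chessboard such that the integer points are the vertices of the squares if $p+q$ is odd, and the centers of the squares if $p+q$ is even; $(x,y)$ denotes the square centered at $(x,y)$. Let $N^{\mathrm I}(L)$ be the set of all squares $(x,y)$ with $x\equiv\frac12(p+q)$ and $y\equiv\frac12(p-q)$ modulo $2q$. Let $R^{\mathrm I}_n(L)$ be the rectangle bounded by $p\le x+y\le p+2nq$ and $-(2n-1)q\le y-x\le(2n-1)q$, and let $W^{\mathrm I}_n(L)$ be the board formed by all squares of $N^{\mathrm I}(L)$ whose centers lie on the boundary or in the interior of $R^{\mathrm I}_n(L)$. Let $W^{\mathrm{II}}_n(L)$, $W^{\mathrm{III}}_n(L)$, $W^{\mathrm{IV}}_n(L)$ be the rotations of $W^{\mathrm I}_n(L)$ by $90^\circ$, $180^\circ$, and $270^\circ$ counterclockwise about $O$. The pinwheel board $W_n(L)$ of order $n$ for $L$ is the union of these four boards. Direction graphs. Let $A_1=\begin{pmatrix}0&1\\1&0\end{pmatrix}$, $A_2=\begin{pmatrix}1&0\\0&1\end{pmatrix}$, $A_3=\begin{pmatrix}-1&0\\0&1\end{pmatrix}$,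 $A_4=\begin{pmatrix}0&-1\\1&0\end{pmatrix}$, and $A_{i+4}=-A_i$ for $i=1,\ldots,4$; these eight are the direction matrices. A move of a skew $(p,q)$-leaper, $p<q$, by a translation $v$ has (skew) direction $i\in\{1,\ldots,8\}$ and direction matrix $A_i$ if $v^T=A_i\binom pq$. A direction graph is a symmetric directed graph whose arcs are labeled with skew directions so that the sum of the associated direction matrices over every simple directed cycle (including two-cycles) is zero. Two direction graphs are the same if there is a label-preserving isomorphism between them. A simple cycle of a skew leaper is trivial if the sum of the direction matrices of its moves (in either orientation) is zero, and nontrivial otherwise. If a leaper graph $G$ of a skew leaper contains no nontrivial cycle, the direction graph extracted from $G$ has the squares of $G$ as vertices and, for each pair of adjacent squares $a,b$, an arc from $a$ to $b$ and an arc from $b$ to $a$, each labeled with the direction of the corresponding move. For an arbitrary $(p,q)$-leaper $L$, $p\le q$, a graph $G$ whose vertices are squares is an $L$-instantiation of a direction graph $\Phi$ if there is a mapping $\tau$ from the vertices of $\Phi$ to the vertices of $G$ such that for every arc in $\Phi$ from $x$ to $y$ labeled $i$, the move by the translation $v$ with $v^T=A_i\binom pq$ leads from $\tau(x)$ to $\tau(y)$. Equivalence permutations. A permutation $\pi$ of the eight skew directions is an equivalence permutation, induced by real $2\times2$ matrices $P$ and $Q$, if $A_{\pi(i)}=PA_iQ$ for all $i$; $\pi(\Phi)$ is obtained from $\Phi$ by applying $\pi$ to every arc label. Duality. For vertices $x,y$ in the same connected component of a direction graph, the distance from $x$ to $y$ is the sum of the direction matrices along any path from $x$ to $y$ (it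 does not depend on the path). A direction graph is coherent if, for all such $x,y$, the distance from $x$ to $y$ is the zero matrix if and only if $x=y$, and is a direction matrix if and only if $x$ and $y$ are joined by an arc. A direction graph $\Phi$ is dual if there exist a direction graph $\Phi'$ (a complement of $\Phi$), a one-to-one mapping $\eta$ between the vertex sets of $\Phi$ and $\Phi'$, and a real $2\times2$ matrix $A_{\mathrm{Dual}}$ (the duality matrix), distinct from all direction matrices, such that: $\Phi$ and $\Phi'$ are coherent and connected; the unlabeled symmetric directed graphs underlying $\Phi$ and $\Phi'$ are isomorphic; and for every arc from $\eta(a)$ to $\eta(b)$ labeled $i$ in $\Phi'$, the distance from $a$ to $b$ in $\Phi$ equals $A_iA_{\mathrm{Dual}}$. *)

theory Defs
  imports
    "HOL-Analysis.Analysis"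
    "HOL-Library.Real_Mod"
    "Graph_Theory.Digraph_Isomorphism"
begin

text \<open>
  Squares are represented by their centres, as vectors of type \<open>real ^ 2\<close>; undirected graphs are
  represented by symmetric digraphs without parallel arcs.
\<close>

section \<open>Leapers and leaper graphs\<close>

definition skew :: "nat \<Rightarrow> nat \<Rightarrow> bool" where
  "skew p q \<longleftrightarrow> p \<noteq> 0 \<and> q \<noteq> 0 \<and> p \<noteq> q"

definition leaper_move :: "nat \<Rightarrow> nat \<Rightarrow> real ^ 2 \<Rightarrow> bool" where
  "leaper_move p q v \<longleftrightarrow>
     (\<exists>s \<in> {1, -1}. \<exists>t \<in> {1, -1}.
        v = vector [s * real p, t * real q] \<or> v = vector [s * real q, t * real p])"

definition leaper_graph :: "nat \<Rightarrow> nat \<Rightarrow> (real ^ 2) set \<Rightarrow> (real ^ 2) pair_pre_digraph" where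
  "leaper_graph p q B =
     \<lparr> pverts = B, parcs = {(a, b). a \<in> B \<and> b \<in> B \<and> leaper_move p q (b - a)} \<rparr>"

section \<open>Pinwheel boards\<close>

text \<open>
  The integer points are the vertices of the squares when \<open>p + q\<close> is odd and their centres
  otherwise, so the coordinate system depends on the leaper.
\<close>

definition squares :: "nat \<Rightarrow> nat \<Rightarrow> (real ^ 2) set" where
  "squares p q =
     (let c = (if odd (p + q) then 1 / 2 else 0)
      in {v. v $ 1 - c \<in> \<int> \<and> v $ 2 - c \<in> \<int>})"

definition pinwheel_N :: "nat \<Rightarrow> nat \<Rightarrow> (real ^ 2) set" where
  "pinwheel_N p q =
     {v \<in> squares p q.
        [v $ 1 = (real p + real q) / 2] (rmod (2 * real q)) \<and>
        [v $ 2 = (real p - real q) / 2] (rmod (2 * real q))}"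

definition pinwheel_R :: "nat \<Rightarrow> nat \<Rightarrow> nat \<Rightarrow> (real ^ 2) set" where
  "pinwheel_R p q n =
     {v. real p \<le> v $ 1 + v $ 2 \<and> v $ 1 + v $ 2 \<le> real p + 2 * real n * real q \<and>
         - ((2 * real n - 1) * real q) \<le> v $ 2 - v $ 1 \<and>
         v $ 2 - v $ 1 \<le> (2 * real n - 1) * real q}"

definition rot90 :: "real ^ 2 \<Rightarrow> real ^ 2" where
  "rot90 v = vector [- (v $ 2), v $ 1]"

definition pinwheel_board :: "nat \<Rightarrow> nat \<Rightarrow> nat \<Rightarrow> (real ^ 2) set" where
  "pinwheel_board p q n = (\<Union>k<4. (rot90 ^^ k) ` (pinwheel_N p q \<inter> pinwheel_R p q n))"

section \<open>Direction graphs\<close>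

definition mat2 :: "real \<Rightarrow> real \<Rightarrow> real \<Rightarrow> real \<Rightarrow> real ^ 2 ^ 2" where
  "mat2 a b c d = vector [vector [a, b], vector [c, d]]"

abbreviation directions :: "nat set" where
  "directions \<equiv> {1..8}"

definition dir_matrix :: "nat \<Rightarrow> real ^ 2 ^ 2" where
  "dir_matrix i =
     (if i = 1 then mat2 0 1 1 0
      else if i = 2 then mat2 1 0 0 1
      else if i = 3 then mat2 (-1) 0 0 1
      else if i = 4 then mat2 0 (-1) 1 0
      else if i = 5 then - mat2 0 1 1 0
      else if i = 6 then - mat2 1 0 0 1
      else if i = 7 then - mat2 (-1) 0 0 1
      else if i = 8 then - mat2 0 (-1) 1 0
      else 0)"

definition dir_translation :: "nat \<Rightarrow> nat \<Rightarrow> nat \<Rightarrow> real ^ 2" where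
  "dir_translation p q i = dir_matrix i *v vector [real p, real q]"

text \<open>Well defined when \<open>p\<close> and \<open>q\<close> are distinct and positive and \<open>v\<close> is a move.\<close>

definition move_direction :: "nat \<Rightarrow> nat \<Rightarrow> real ^ 2 \<Rightarrow> nat" where
  "move_direction p q v = (THE i. i \<in> directions \<and> v = dir_translation p q i)"

record 'a labelled_digraph =
  skeleton :: "'a pair_pre_digraph"
  label :: "'a \<times> 'a \<Rightarrow> nat"

definition dir_sum :: "'a labelled_digraph \<Rightarrow> ('a \<times> 'a) list \<Rightarrow> real ^ 2 ^ 2" where
  "dir_sum \<Phi> w = (\<Sum>e\<leftarrow>w. dir_matrix (label \<Phi> e))"

text \<open>
  The library's notion of cycle is the directed one: two-cycles (and loops) are included.
\<close>

definition direction_graph :: "'a labelled_digraph \<Rightarrow> bool" where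
  "direction_graph \<Phi> \<longleftrightarrow>
     pair_sym_digraph (skeleton \<Phi>) \<and>
     (\<forall>e \<in> parcs (skeleton \<Phi>). label \<Phi> e \<in> directions) \<and>
     (\<forall>c. pre_digraph.cycle (with_proj (skeleton \<Phi>)) c \<longrightarrow> dir_sum \<Phi> c = 0)"

definition same_direction_graph :: "'a labelled_digraph \<Rightarrow> 'b labelled_digraph \<Rightarrow> bool" where
  "same_direction_graph \<Phi> \<Psi> \<longleftrightarrow>
     (\<exists>f. pre_digraph.digraph_isomorphism (with_proj (skeleton \<Phi>)) f \<and>
          with_proj (skeleton \<Psi>) = app_iso f (with_proj (skeleton \<Phi>)) \<and>
          (\<forall>e \<in> parcs (skeleton \<Phi>). label \<Psi> (iso_arcs f e) = label \<Phi> e))"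

text \<open>
  The simple cycles of an undirected graph are the directed cycles of length at least three of the
  corresponding symmetric digraph, each occurring in both orientations.
\<close>

definition nontrivial_cycle ::
  "nat \<Rightarrow> nat \<Rightarrow> (real ^ 2) pair_pre_digraph \<Rightarrow> ((real ^ 2) \<times> (real ^ 2)) list \<Rightarrow> bool" where
  "nontrivial_cycle p q G c \<longleftrightarrow>
     pre_digraph.cycle (with_proj G) c \<and> 3 \<le> length c \<and>
     (\<Sum>(a, b)\<leftarrow>c. dir_matrix (move_direction p q (b - a))) \<noteq> 0"

definition trivial_leaper_graph :: "nat \<Rightarrow> nat \<Rightarrow> (real ^ 2) pair_pre_digraph \<Rightarrow> bool" where
  "trivial_leaper_graph p q G \<longleftrightarrow> (\<nexists>c. nontrivial_cycle p q G c)"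

definition extracted :: "nat \<Rightarrow> nat \<Rightarrow> (real ^ 2) pair_pre_digraph \<Rightarrow> (real ^ 2) labelled_digraph"
  where
  "extracted p q G = \<lparr> skeleton = G, label = (\<lambda>(a, b). move_direction p q (b - a)) \<rparr>"

definition instantiation_of ::
  "nat \<Rightarrow> nat \<Rightarrow> (real ^ 2) pair_pre_digraph \<Rightarrow> 'a labelled_digraph \<Rightarrow> bool" where
  "instantiation_of p q G \<Phi> \<longleftrightarrow>
     (\<exists>\<tau>. \<tau> ` pverts (skeleton \<Phi>) \<subseteq> pverts G \<and>
          (\<forall>(x, y) \<in> parcs (skeleton \<Phi>). \<tau> y = \<tau> x + dir_translation p q (label \<Phi> (x, y))))"

section \<open>Equivalence permutations\<close>

definition equivalence_permutation ::
  "(nat \<Rightarrow> nat) \<Rightarrow> real ^ 2 ^ 2 \<Rightarrow> real ^ 2 ^ 2 \<Rightarrow> bool" where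
  "equivalence_permutation \<pi> P Q \<longleftrightarrow>
     \<pi> permutes directions \<and>
     (\<forall>i \<in> directions. dir_matrix (\<pi> i) = P ** dir_matrix i ** Q)"

definition permute_labels :: "(nat \<Rightarrow> nat) \<Rightarrow> 'a labelled_digraph \<Rightarrow> 'a labelled_digraph" where
  "permute_labels \<pi> \<Phi> = \<Phi>\<lparr> label := \<pi> \<circ> label \<Phi> \<rparr>"

definition pinwheel_perm :: "nat \<Rightarrow> nat" where
  "pinwheel_perm i = (if i \<in> directions then [3, 8, 5, 2, 7, 4, 1, 6] ! (i - 1) else i)"

definition reflect_perm :: "nat \<Rightarrow> nat" where
  "reflect_perm i = (if i \<in> directions then 9 - i else i)"

section \<open>Duality\<close>

text \<open>
  Well defined for vertices in the same component of a direction graph, since there all closed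
  walks have zero sum.
\<close>

definition distance :: "'a labelled_digraph \<Rightarrow> 'a \<Rightarrow> 'a \<Rightarrow> real ^ 2 ^ 2" where
  "distance \<Phi> x y =
     (THE M. \<exists>w. pre_digraph.awalk (with_proj (skeleton \<Phi>)) x w y \<and> M = dir_sum \<Phi> w)"

definition coherent :: "'a labelled_digraph \<Rightarrow> bool" where
  "coherent \<Phi> \<longleftrightarrow>
     (\<forall>x y. reachable (with_proj (skeleton \<Phi>)) x y \<longrightarrow>
        (distance \<Phi> x y = 0 \<longleftrightarrow> x = y) \<and>
        (distance \<Phi> x y \<in> dir_matrix ` directions \<longleftrightarrow> (x, y) \<in> parcs (skeleton \<Phi>)))"

definition dual_via :: "'a labelled_digraph \<Rightarrow> 'b labelled_digraph \<Rightarrow> real ^ 2 ^ 2 \<Rightarrow> bool" where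
  "dual_via \<Phi> \<Phi>' D \<longleftrightarrow>
     direction_graph \<Phi> \<and> direction_graph \<Phi>' \<and>
     D \<notin> dir_matrix ` directions \<and>
     coherent \<Phi> \<and> coherent \<Phi>' \<and>
     Digraph_Component.connected (with_proj (skeleton \<Phi>)) \<and>
     Digraph_Component.connected (with_proj (skeleton \<Phi>')) \<and>
     digraph_iso (with_proj (skeleton \<Phi>)) (with_proj (skeleton \<Phi>')) \<and>
     (\<exists>\<eta>. bij_betw \<eta> (pverts (skeleton \<Phi>)) (pverts (skeleton \<Phi>')) \<and>
          (\<forall>a \<in> pverts (skeleton \<Phi>). \<forall>b \<in> pverts (skeleton \<Phi>).
             (\<eta> a, \<eta> b) \<in> parcs (skeleton \<Phi>') \<longrightarrow>
             distance \<Phi> a b = dir_matrix (label \<Phi>' (\<eta> a, \<eta> b)) ** D))"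

end

theory Submission
  imports Defs
begin

text \<open>
  The argument rests on one substitution: the centre of every square of the pinwheel board has
  coordinates \<open>M (p, q)\<^sup>T\<close>, where \<open>M\<close> runs over a finite set \<open>cells n\<close> of half-integral matrices that
  depends on \<open>n\<close> only (\<open>pinwheel_board_eq\<close>). The entries of a difference of two cells satisfy
  parity constraints, and these imply, for \<open>0 < p < q\<close>, that distinct cells give distinct squares
  (\<open>inj_on_eval_cells\<close>) and that two squares are joined by a move exactly when the difference of
  their cells is a direction matrix (\<open>leaper_move_cells_iff\<close>). Hence the leaper graph is the same
  for all skew leapers, and a move from the cell \<open>M\<close> to the cell \<open>N\<close> has direction matrix
  \<open>N - M\<close>.

  So the cell is a potential for the direction matrices: the sum along a walk from \<open>M\<close> to \<open>N\<close>
  is \<open>N - M\<close>. Cycles therefore have sum zero, which gives triviality, and distances are differences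
  of cells, which gives coherence. Relabelling by an equivalence permutation that is induced by \<open>P\<close>
  and \<open>Q\<close> replaces the potential \<open>M\<close> by \<open>P M Q\<close>.

  For the duality, let \<open>P\<close> and \<open>Q\<close> induce the permutation of the labels and let \<open>D\<close> be the duality
  matrix. The condition on \<open>\<eta>\<close> says that \<open>M \<mapsto> P M Q D\<close> carries differences of the images under
  \<open>\<eta>\<close> back to the original differences. This linear map is an involution (\<open>dual_map_dual_map\<close>)
  that preserves \<open>cells n\<close> (\<open>dual_map_cells\<close>); when \<open>n\<close> is even, the reflection in \<open>P\<close> is needed for
  this. So \<open>\<eta>\<close> can be taken to be this map itself.
\<close>

section \<open>Two-by-two matrices and direction matrices\<close>

lemma mat2_nth [simp]:
  "mat2 a b c d $ 1 $ 1 = a" "mat2 a b c d $ 1 $ 2 = b"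
  "mat2 a b c d $ 2 $ 1 = c" "mat2 a b c d $ 2 $ 2 = d"
  by (simp_all add: mat2_def)

lemma mat2_eq_iff [simp]:
  "mat2 a b c d = mat2 a' b' c' d' \<longleftrightarrow> a = a' \<and> b = b' \<and> c = c' \<and> d = d'"
  by (auto simp: vec_eq_iff forall_2)

lemma mat2_diff: "mat2 a b c d - mat2 a' b' c' d' = mat2 (a - a') (b - b') (c - c') (d - d')"
  by (simp add: vec_eq_iff forall_2)

lemma mat2_uminus: "- mat2 a b c d = mat2 (- a) (- b) (- c) (- d)"
  by (simp add: vec_eq_iff forall_2)

lemma mat2_mult:
  "mat2 a b c d ** mat2 a' b' c' d' =
     mat2 (a * a' + b * c') (a * b' + b * d') (c * a' + d * c') (c * b' + d * d')"
  by (simp add: vec_eq_iff forall_2 matrix_matrix_mult_def sum_2)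

lemma mat2_mult_vector: "mat2 a b c d *v vector [x, y] = vector [a * x + b * y, c * x + d * y]"
  by (simp add: vec_eq_iff forall_2 matrix_vector_mult_def sum_2)

lemma mat2_cases: obtains a b c d where "M = mat2 a b c d"
proof
  show "M = mat2 (M $ 1 $ 1) (M $ 1 $ 2) (M $ 2 $ 1) (M $ 2 $ 2)"
    by (simp add: vec_eq_iff forall_2)
qed

lemma vector_2_eq_iff [simp]:
  "(vector [x, y] :: real ^ 2) = vector [x', y'] \<longleftrightarrow> x = x' \<and> y = y'"
  by (auto simp: vec_eq_iff forall_2)

lemma directions_eq: "directions = {1, 2, 3, 4, 5, 6, 7, 8}"
  by auto

lemma dir_matrix_simps:
  "dir_matrix 1 = mat2 0 1 1 0" "dir_matrix 2 = mat2 1 0 0 1"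
  "dir_matrix 3 = mat2 (-1) 0 0 1" "dir_matrix 4 = mat2 0 (-1) 1 0"
  "dir_matrix 5 = mat2 0 (-1) (-1) 0" "dir_matrix 6 = mat2 (-1) 0 0 (-1)"
  "dir_matrix 7 = mat2 1 0 0 (-1)" "dir_matrix 8 = mat2 0 1 (-1) 0"
  by (simp_all add: dir_matrix_def mat2_uminus)

lemma dir_matrices_eq:
  "dir_matrix ` directions =
     {mat2 0 1 1 0, mat2 1 0 0 1, mat2 (-1) 0 0 1, mat2 0 (-1) 1 0,
      mat2 0 (-1) (-1) 0, mat2 (-1) 0 0 (-1), mat2 1 0 0 (-1), mat2 0 1 (-1) 0}"
  unfolding directions_eq image_insert image_empty dir_matrix_simps ..

lemma mat2_in_dir_matrices_iff:
  "mat2 a b c d \<in> dir_matrix ` directions \<longleftrightarrow>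
     \<bar>a\<bar> = 1 \<and> b = 0 \<and> c = 0 \<and> \<bar>d\<bar> = 1 \<or> a = 0 \<and> \<bar>b\<bar> = 1 \<and> \<bar>c\<bar> = 1 \<and> d = 0"
  unfolding dir_matrices_eq by (simp add: abs_if) (smt (verit))

lemma dir_matrices_uminus_iff:
  "- M \<in> dir_matrix ` directions \<longleftrightarrow> M \<in> dir_matrix ` directions"
  by (cases M rule: mat2_cases) (simp only: mat2_uminus mat2_in_dir_matrices_iff, simp)

lemma matrix_diff_sandwich:
  fixes P A B Q :: "real ^ 2 ^ 2"
  shows "P ** (A - B) ** Q = P ** A ** Q - P ** B ** Q"
  by (cases P rule: mat2_cases; cases Q rule: mat2_cases; cases A rule: mat2_cases; cases B rule: mat2_cases)
     (simp add: mat2_mult mat2_diff algebra_simps)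

section \<open>Direction graphs with a potential\<close>

text \<open>
  A potential assigns a matrix to every vertex so that the direction matrix of each arc is the
  difference of the values at its ends, head minus tail; in particular all labels are directions.
  Walk sums then telescope.
\<close>

definition potential :: "'a labelled_digraph \<Rightarrow> ('a \<Rightarrow> real ^ 2 ^ 2) \<Rightarrow> bool" where
  "potential \<Phi> \<phi> \<longleftrightarrow>
     (\<forall>(x, y) \<in> parcs (skeleton \<Phi>).
        label \<Phi> (x, y) \<in> directions \<and> dir_matrix (label \<Phi> (x, y)) = \<phi> y - \<phi> x)"

lemma dir_sum_walk:
  assumes "potential \<Phi> \<phi>" "set w \<subseteq> parcs (skeleton \<Phi>)" "pcas u w v"
  shows "dir_sum \<Phi> w = \<phi> v - \<phi> u"
  using assms(2,3)
proof (induction w arbitrary: u)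
  case Nil
  then show ?case by (simp add: dir_sum_def)
next
  case (Cons e w)
  have "dir_matrix (label \<Phi> e) = \<phi> (snd e) - \<phi> (fst e)"
    using Cons.prems(1) assms(1) by (cases e) (auto simp: potential_def)
  moreover have "dir_sum \<Phi> w = \<phi> v - \<phi> (snd e)"
    using Cons by simp
  ultimately show ?case
    using Cons.prems(2) by (simp add: dir_sum_def)
qed

lemma dir_sum_awalk:
  assumes "potential \<Phi> \<phi>" "pre_digraph.awalk (with_proj (skeleton \<Phi>)) u w v"
  shows "dir_sum \<Phi> w = \<phi> v - \<phi> u"
  using assms by (auto simp: pre_digraph.awalk_def cas_with_proj_eq intro: dir_sum_walk)

lemma dir_sum_cycle:
  assumes "potential \<Phi> \<phi>" "pre_digraph.cycle (with_proj (skeleton \<Phi>)) c"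
  shows "dir_sum \<Phi> c = 0"
  using assms by (auto simp: pre_digraph.cycle_def dest: dir_sum_awalk)

lemma direction_graph_of_potential:
  assumes "pair_sym_digraph (skeleton \<Phi>)" "potential \<Phi> \<phi>"
  shows "direction_graph \<Phi>"
  using assms dir_sum_cycle[OF assms(2)] by (auto simp: direction_graph_def potential_def)

lemma distance_of_potential:
  assumes "pair_sym_digraph (skeleton \<Phi>)" "potential \<Phi> \<phi>"
    and "reachable (with_proj (skeleton \<Phi>)) x y"
  shows "distance \<Phi> x y = \<phi> y - \<phi> x"
proof -
  interpret pair_sym_digraph "skeleton \<Phi>" by (rule assms(1))
  obtain w where "awalk x w y"
    using assms(3) by (auto simp: reachable_awalk)
  then show ?thesis
    unfolding distance_def using dir_sum_awalk[OF assms(2)]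
    by (intro the_equality) auto
qed

lemma coherent_of_potential:
  assumes "pair_sym_digraph (skeleton \<Phi>)" "potential \<Phi> \<phi>"
    and inj: "inj_on \<phi> (pverts (skeleton \<Phi>))"
    and arcs: "\<And>x y. x \<in> pverts (skeleton \<Phi>) \<Longrightarrow> y \<in> pverts (skeleton \<Phi>) \<Longrightarrow>
      \<phi> y - \<phi> x \<in> dir_matrix ` directions \<longleftrightarrow> (x, y) \<in> parcs (skeleton \<Phi>)"
  shows "coherent \<Phi>"
  unfolding coherent_def
proof (intro allI impI)
  fix x y assume r: "reachable (with_proj (skeleton \<Phi>)) x y"
  interpret pair_sym_digraph "skeleton \<Phi>" by (rule assms(1))
  have xy: "x \<in> pverts (skeleton \<Phi>)" "y \<in> pverts (skeleton \<Phi>)"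
    using reachable_in_verts[OF r] by auto
  show "(distance \<Phi> x y = 0) = (x = y) \<and>
        (distance \<Phi> x y \<in> dir_matrix ` directions) = ((x, y) \<in> parcs (skeleton \<Phi>))"
    using arcs[OF xy] inj xy by (auto simp: distance_of_potential[OF assms(1,2) r] inj_on_def)
qed

section \<open>Cells of the pinwheel board\<close>

text \<open>
  The matrix \<open>M\<close> describes the square with centre \<open>M (p, q)\<^sup>T\<close>, uniformly for all leapers.
\<close>

definition eval :: "nat \<Rightarrow> nat \<Rightarrow> real ^ 2 ^ 2 \<Rightarrow> real ^ 2" where
  "eval p q M = M *v vector [real p, real q]"

lemma eval_mat2: "eval p q (mat2 a b c d) = vector [a * p + b * q, c * p + d * q]"
  by (simp add: eval_def mat2_mult_vector)

lemma eval_diff: "eval p q (M - N) = eval p q M - eval p q N"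
  by (simp add: eval_def matrix_vector_mult_diff_rdistrib)

text \<open>
  The signs \<open>(e, f)\<close> are those of the four quarters of the board: \<open>(1, 1)\<close> for the first one, and
  a quarter turn takes \<open>(e, f)\<close> to \<open>(- f, e)\<close>. Within the first quarter, the square \<open>(x, y)\<close> has
  \<open>x + y = p + 2 q s\<close> and \<open>y - x = (2 d - 1) q\<close>, so that \<open>s\<close> and \<open>d\<close> count the diagonals in the two
  directions; reading columns as complex numbers, the cell is
  \<open>(\<epsilon> / 2, (\<epsilon> / 2) (2 s + (2 d - 1) \<i>))\<close> with \<open>\<epsilon> = e + f \<i>\<close>.
\<close>

definition cell :: "int \<Rightarrow> int \<Rightarrow> int \<Rightarrow> int \<Rightarrow> real ^ 2 ^ 2" where
  "cell e f s d = mat2 (e / 2) (e * s - f * (d - 1 / 2)) (f / 2) (f * s + e * (d - 1 / 2))"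

text \<open>
  The positions \<open>(s, d)\<close> within a quarter, which are the same for all four. The parity condition
  expresses that \<open>x\<close> and \<open>y\<close> lie in the prescribed classes modulo \<open>2 q\<close>: in the first quarter these
  are \<open>x = (p + q) / 2 + 2 q a\<close> and \<open>y = (p - q) / 2 + 2 q b\<close> with \<open>s = a + b\<close> and \<open>d = b - a\<close>.
\<close>

definition in_quarter :: "nat \<Rightarrow> int \<Rightarrow> int \<Rightarrow> bool" where
  "in_quarter n s d \<longleftrightarrow> 0 \<le> s \<and> s \<le> int n \<and> 1 - int n \<le> d \<and> d \<le> int n \<and> even (s + d)"

text \<open>The cells of the pinwheel board of order \<open>n\<close>.\<close>

definition cells :: "nat \<Rightarrow> (real ^ 2 ^ 2) set" where
  "cells n = {cell e f s d | e f s d. e \<in> {1, -1} \<and> f \<in> {1, -1} \<and> in_quarter n s d}"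

lemma cell_in_cells:
  "e \<in> {1, -1} \<Longrightarrow> f \<in> {1, -1} \<Longrightarrow> in_quarter n s d \<Longrightarrow> cell e f s d \<in> cells n"
  unfolding cells_def by blast

lemma rot90_eval_cell: "rot90 (eval p q (cell e f s d)) = eval p q (cell (- f) e s d)"
  by (simp add: rot90_def cell_def eval_mat2 algebra_simps)

lemma first_quarter_eq:
  assumes "0 < q"
  shows "pinwheel_N p q \<inter> pinwheel_R p q n = {eval p q (cell 1 1 s d) | s d. in_quarter n s d}"
    (is "?L = ?R")
proof
  show "?L \<subseteq> ?R"
  proof
    fix v assume "v \<in> ?L"
    then have N: "v \<in> pinwheel_N p q" and R: "v \<in> pinwheel_R p q n" by auto
    from N have "[(real p + real q) / 2 = v $ 1] (rmod (2 * real q))"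
      unfolding pinwheel_N_def by (auto intro: rcong_sym)
    then obtain a where a: "v $ 1 = (real p + real q) / 2 + of_int a * (2 * real q)"
      unfolding rcong_altdef by blast
    from N have "[(real p - real q) / 2 = v $ 2] (rmod (2 * real q))"
      unfolding pinwheel_N_def by (auto intro: rcong_sym)
    then obtain b where b: "v $ 2 = (real p - real q) / 2 + of_int b * (2 * real q)"
      unfolding rcong_altdef by blast
    have q: "real q > 0" using assms by simp
    have sum: "v $ 1 + v $ 2 = p + real q * (2 * of_int (a + b))"
      and diff: "v $ 2 - v $ 1 = real q * (2 * of_int (b - a) - 1)"
      unfolding a b by (simp_all add: field_simps)
    have "0 \<le> real q * (2 * of_int (a + b))" "real q * (2 * of_int (a + b)) \<le> real q * (2 * real n)"
      "real q * (- (2 * real n - 1)) \<le> real q * (2 * of_int (b - a) - 1)"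
      "real q * (2 * of_int (b - a) - 1) \<le> real q * (2 * real n - 1)"
      using R[unfolded pinwheel_R_def mem_Collect_eq sum diff] by (simp_all add: algebra_simps)
    then have "0 \<le> real_of_int (a + b)" "real_of_int (a + b) \<le> real n"
      "1 - real n \<le> real_of_int (b - a)" "real_of_int (b - a) \<le> real n"
      unfolding mult_le_cancel_left_pos[OF q] using q by (simp_all add: zero_le_mult_iff)
    then have "in_quarter n (a + b) (b - a)"
      unfolding in_quarter_def by auto
    moreover have "v = eval p q (cell 1 1 (a + b) (b - a))"
      by (simp add: vec_eq_iff forall_2 cell_def eval_mat2 a b field_simps)
    ultimately show "v \<in> ?R" by blast
  qed
  show "?R \<subseteq> ?L"
  proof
    fix v assume "v \<in> ?R"
    then obtain s d where v: "v = eval p q (cell 1 1 s d)" and sd: "in_quarter n s d" by blast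
    from sd have ev: "even (s + d)" by (simp add: in_quarter_def)
    then obtain b where b: "s + d = 2 * b" by (elim evenE)
    define a where "a = b - d"
    have s: "s = a + b" and d: "d = b - a" using b by (auto simp: a_def)
    have v1: "v $ 1 = (real p + real q) / 2 + of_int a * (2 * real q)"
      and v2: "v $ 2 = (real p - real q) / 2 + of_int b * (2 * real q)"
      by (simp_all add: v s d cell_def eval_mat2 field_simps)
    have "v \<in> squares p q"
    proof (cases "odd (p + q)")
      case True
      then obtain k where k: "p + q = 2 * k + 1" by (elim oddE)
      have pk: "real p = 2 * real k + 1 - real q" using k by linarith
      have "v $ 1 - 1 / 2 = of_int (int k + 2 * a * int q)"
        "v $ 2 - 1 / 2 = of_int (int k - int q + 2 * b * int q)"
        unfolding v1 v2 pk by (simp_all add: field_simps)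
      then show ?thesis using True unfolding squares_def Let_def by (auto intro: Ints_of_int)
    next
      case False
      then have "even (p + q)" by simp
      then obtain k where k: "p + q = 2 * k" by (elim evenE)
      have pk: "real p = 2 * real k - real q" using k by linarith
      have "v $ 1 - 0 = of_int (int k + 2 * a * int q)"
        "v $ 2 - 0 = of_int (int k - int q + 2 * b * int q)"
        unfolding v1 v2 pk by (simp_all add: field_simps)
      then show ?thesis using False unfolding squares_def Let_def by (auto intro: Ints_of_int)
    qed
    moreover have "[v $ 1 = (real p + real q) / 2] (rmod (2 * real q))"
      "[v $ 2 = (real p - real q) / 2] (rmod (2 * real q))"
      using v1 v2 by (blast intro: rcong_sym rcong_altdef[THEN iffD2])+
    ultimately have "v \<in> pinwheel_N p q"
      unfolding pinwheel_N_def by blast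
    moreover have "v \<in> pinwheel_R p q n"
    proof -
      have q: "real q \<ge> 0" by simp
      have sum: "v $ 1 + v $ 2 = p + real q * (2 * of_int s)"
        and diff: "v $ 2 - v $ 1 = real q * (2 * of_int d - 1)"
        unfolding v1 v2 s d by (simp_all add: field_simps)
      have "0 \<le> real_of_int s" "real_of_int s \<le> real n"
        "1 - real n \<le> real_of_int d" "real_of_int d \<le> real n"
        using sd unfolding in_quarter_def by linarith+
      then have "real q * 0 \<le> real q * (2 * of_int s)" "real q * (2 * of_int s) \<le> real q * (2 * real n)"
        "real q * (- (2 * real n - 1)) \<le> real q * (2 * of_int d - 1)"
        "real q * (2 * of_int d - 1) \<le> real q * (2 * real n - 1)"
        by (intro mult_left_mono q; simp)+
      then show ?thesis unfolding pinwheel_R_def mem_Collect_eq sum diff by (simp add: algebra_simps)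
    qed
    ultimately show "v \<in> ?L" by blast
  qed
qed

lemma pinwheel_board_eq:
  assumes "0 < q"
  shows "pinwheel_board p q n = eval p q ` cells n"
proof -
  define quarter where "quarter e f = {eval p q (cell e f s d) | s d. in_quarter n s d}" for e f
  have turn: "rot90 ` quarter e f = quarter (- f) e" for e f
  proof (intro set_eqI iffI)
    fix v assume "v \<in> rot90 ` quarter e f"
    then show "v \<in> quarter (- f) e"
      unfolding quarter_def using rot90_eval_cell by blast
  next
    fix v assume "v \<in> quarter (- f) e"
    then obtain s d where "v = eval p q (cell (- f) e s d)" "in_quarter n s d"
      unfolding quarter_def by blast
    then show "v \<in> rot90 ` quarter e f"
      unfolding quarter_def rot90_eval_cell[symmetric] by blast
  qed
  have four: "{..<4::nat} = {0, Suc 0, Suc (Suc 0), Suc (Suc (Suc 0))}" by auto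
  have "pinwheel_board p q n = (\<Union>k<4. (rot90 ^^ k) ` quarter 1 1)"
    unfolding pinwheel_board_def first_quarter_eq[OF assms] quarter_def ..
  also have "\<dots> = quarter 1 1 \<union> quarter (-1) 1 \<union> quarter (-1) (-1) \<union> quarter 1 (-1)"
    unfolding four by (simp add: image_comp[symmetric] turn Un_assoc del: comp_apply)
  also have "\<dots> = eval p q ` cells n"
    unfolding cells_def quarter_def by fast
  finally show ?thesis .
qed

section \<open>Moves between cells\<close>

text \<open>
  The parity of \<open>s + d\<close> links the two columns of a cell: up to multiples of \<open>2\<close>, the second column
  is the first one turned clockwise by a right angle. Differences of cells inherit this relation.
\<close>

lemma cell_form:
  assumes "M \<in> cells n"
  obtains e f u v :: int where "e \<in> {1, -1}" "f \<in> {1, -1}"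
    "M = mat2 (e / 2) (f / 2 + 2 * u) (f / 2) (2 * v - e / 2)"
proof -
  obtain e f s d where M: "M = cell e f s d" and ef: "e \<in> {1, -1}" "f \<in> {1, -1}"
    and "even (s + d)"
    using assms unfolding cells_def in_quarter_def by blast
  then have "even (e * s - f * d)" "even (f * s + e * d)" by auto
  then obtain u v where u: "e * s - f * d = 2 * u" and v: "f * s + e * d = 2 * v"
    by (elim evenE)
  have "real_of_int (e * s - f * d) = of_int (2 * u)" "real_of_int (f * s + e * d) = of_int (2 * v)"
    using u v by simp_all
  then have "M = mat2 (e / 2) (f / 2 + 2 * u) (f / 2) (2 * v - e / 2)"
    unfolding M cell_def by (simp add: algebra_simps)
  with ef show thesis by (rule that)
qed

lemma cell_diff_form:
  assumes "M \<in> cells n" "N \<in> cells n"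
  obtains a c u v :: int where "\<bar>a\<bar> \<le> 1" "\<bar>c\<bar> \<le> 1"
    "N - M = mat2 a (real_of_int (c + 2 * u)) c (real_of_int (2 * v - a))"
proof -
  obtain e f u v :: int where 1: "e \<in> {1, -1}" "f \<in> {1, -1}"
    "M = mat2 (e / 2) (f / 2 + 2 * u) (f / 2) (2 * v - e / 2)"
    using assms(1) by (rule cell_form)
  obtain e' f' u' v' :: int where 2: "e' \<in> {1, -1}" "f' \<in> {1, -1}"
    "N = mat2 (e' / 2) (f' / 2 + 2 * u') (f' / 2) (2 * v' - e' / 2)"
    using assms(2) by (rule cell_form)
  have "even (e' - e)" "even (f' - f)" using 1 2 by auto
  then obtain a c where a: "e' - e = 2 * a" and c: "f' - f = 2 * c" by (elim evenE)
  have a': "real_of_int a = e' / 2 - e / 2" and c': "real_of_int c = f' / 2 - f / 2"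
    using arg_cong[OF a, of real_of_int] arg_cong[OF c, of real_of_int] by simp_all
  show thesis
  proof (rule that)
    show "\<bar>a\<bar> \<le> 1" "\<bar>c\<bar> \<le> 1" using 1 2 a c by auto
    show "N - M = mat2 a (real_of_int (c + 2 * (u' - u))) c (real_of_int (2 * (v' - v) - a))"
      unfolding 1(3) 2(3) mat2_diff by (simp add: a' c')
  qed
qed

text \<open>If \<open>k\<close> divides a nonzero \<open>y\<close>, then \<open>y q\<close> is too large to be cancelled by \<open>x p\<close>.\<close>

lemma small_combination_eq_0:
  fixes x y p q :: int
  assumes "x * p + y * q = 0" "\<bar>x * p\<bar> < \<bar>k\<bar> * q" "k dvd y" "0 < p" "0 < q"
  shows "x = 0 \<and> y = 0"
proof -
  have "y = 0"
  proof (rule ccontr)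
    assume "y \<noteq> 0"
    then have "\<bar>k\<bar> \<le> \<bar>y\<bar>" using assms(3) by (simp add: dvd_imp_le_int)
    then have "\<bar>k\<bar> * q \<le> \<bar>y\<bar> * q" using assms(5) by simp
    also have "\<dots> = \<bar>x * p\<bar>" using assms(1,5) by (simp add: abs_mult eq_neg_iff_add_eq_0[symmetric])
    finally show False using assms(2) by simp
  qed
  then show ?thesis using assms by simp
qed

lemma cell_eq_if_eval_eq:
  assumes "0 < p" "p < q" "M \<in> cells n" "N \<in> cells n" "eval p q N = eval p q M"
  shows "N = M"
proof -
  obtain a c u v :: int where b: "\<bar>a\<bar> \<le> 1" "\<bar>c\<bar> \<le> 1" and
    NM: "N - M = mat2 a (real_of_int (c + 2 * u)) c (real_of_int (2 * v - a))"
    using assms(3,4) by (rule cell_diff_form)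
  have "eval p q (N - M) = vector [0, 0]"
    using assms(5) by (simp add: eval_diff vec_eq_iff forall_2)
  then have "real_of_int (a * int p + (c + 2 * u) * int q) = of_int 0"
    "real_of_int (c * int p + (2 * v - a) * int q) = of_int 0"
    unfolding NM eval_mat2 by simp_all
  then have eqs: "a * int p + (c + 2 * u) * int q = 0" "c * int p + (2 * v - a) * int q = 0"
    unfolding of_int_eq_iff by blast+
  have "\<bar>a * int p\<bar> \<le> 1 * int p" "\<bar>c * int p\<bar> \<le> 1 * int p"
    unfolding abs_mult using mult_right_mono[OF b(1), of "int p"] mult_right_mono[OF b(2), of "int p"] by auto
  then have "a = 0 \<and> c + 2 * u = 0" "c = 0 \<and> 2 * v - a = 0"
    using small_combination_eq_0[OF eqs(1), of 1] small_combination_eq_0[OF eqs(2), of 1] assms(1,2)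
    by simp_all
  then have "N - M = mat2 0 0 0 0" unfolding NM by simp
  then show ?thesis by (simp add: vec_eq_iff forall_2)
qed

lemma inj_on_eval_cells:
  "0 < p \<Longrightarrow> p < q \<Longrightarrow> inj_on (eval p q) (cells n)"
  by (blast intro: inj_onI cell_eq_if_eval_eq)

lemma leaper_move_eval_dir_matrix:
  assumes "M \<in> dir_matrix ` directions"
  shows "leaper_move p q (eval p q M)"
  using assms unfolding dir_matrices_eq leaper_move_def
  by (elim insertE emptyE) (simp_all add: eval_mat2)

text \<open>
  One coordinate of a move is \<open>\<plusminus> q\<close>, which forces the coefficient of \<open>q\<close> in the other coordinate to
  be even. This excludes the coincidence \<open>q - p = p\<close> when \<open>q = 2 p\<close>.
\<close>

lemma long_short_coordinates:
  fixes a c u w p q \<sigma> \<tau> :: int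
  assumes "0 < p" "p < q" "\<bar>a\<bar> \<le> 1" "\<bar>c\<bar> \<le> 1" "\<bar>\<sigma>\<bar> = 1" "\<bar>\<tau>\<bar> = 1"
    and long: "c * p + w * q = \<tau> * q"
    and short: "a * p + (c + 2 * u) * q = \<sigma> * p"
  shows "c = 0 \<and> w = \<tau> \<and> a = \<sigma> \<and> c + 2 * u = 0"
proof -
  have "c * p + (w - \<tau>) * q = 0" using long by (simp add: algebra_simps)
  moreover have "\<bar>c * p\<bar> \<le> 1 * p" unfolding abs_mult using assms(1,4) by (intro mult_mono) auto
  ultimately have c: "c = 0 \<and> w - \<tau> = 0"
    using assms(1,2) by (intro small_combination_eq_0[where k = 1 and q = q and p = p]) auto
  \<comment> \<open>The bound on \<open>a - \<sigma>\<close> is only \<open>2\<close>, but \<open>c + 2 * u\<close> is even because \<open>c = 0\<close>.\<close>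
  have "(a - \<sigma>) * p + (c + 2 * u) * q = 0" using short by (simp add: algebra_simps)
  moreover have "\<bar>(a - \<sigma>) * p\<bar> \<le> 2 * p" unfolding abs_mult using assms(1,3,5) by (intro mult_mono) auto
  ultimately have "a - \<sigma> = 0 \<and> c + 2 * u = 0"
    using assms(1,2) c by (intro small_combination_eq_0[where k = 2 and q = q and p = p]) auto
  with c show ?thesis by simp
qed

lemma leaper_move_cells_iff:
  assumes "0 < p" "p < q" "M \<in> cells n" "N \<in> cells n"
  shows "leaper_move p q (eval p q N - eval p q M) \<longleftrightarrow> N - M \<in> dir_matrix ` directions"
proof
  assume "N - M \<in> dir_matrix ` directions"
  then show "leaper_move p q (eval p q N - eval p q M)"
    using leaper_move_eval_dir_matrix by (simp add: eval_diff[symmetric])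
next
  assume "leaper_move p q (eval p q N - eval p q M)"
  then have "leaper_move p q (eval p q (N - M))" by (simp add: eval_diff)
  moreover obtain a c u v :: int where b: "\<bar>a\<bar> \<le> 1" "\<bar>c\<bar> \<le> 1" and
    NM: "N - M = mat2 a (real_of_int (c + 2 * u)) c (real_of_int (2 * v - a))"
    using assms(3,4) by (rule cell_diff_form)
  ultimately obtain \<sigma> \<tau> :: int where st: "\<bar>\<sigma>\<bar> = 1" "\<bar>\<tau>\<bar> = 1" and cases:
    "real_of_int (a * int p + (c + 2 * u) * int q) = of_int (\<sigma> * int p) \<and>
     real_of_int (c * int p + (2 * v - a) * int q) = of_int (\<tau> * int q) \<or>
     real_of_int (a * int p + (c + 2 * u) * int q) = of_int (\<sigma> * int q) \<and>
     real_of_int (c * int p + (2 * v - a) * int q) = of_int (\<tau> * int p)"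
  proof -
    assume "leaper_move p q (eval p q (N - M))"
    then obtain s t :: real where "s \<in> {1, -1}" "t \<in> {1, -1}" and
      "eval p q (N - M) = vector [s * real p, t * real q] \<or>
       eval p q (N - M) = vector [s * real q, t * real p]"
      unfolding leaper_move_def by blast
    moreover obtain \<sigma> \<tau> :: int where "s = of_int \<sigma>" "t = of_int \<tau>" "\<bar>\<sigma>\<bar> = 1" "\<bar>\<tau>\<bar> = 1"
    proof
      show "s = of_int (if s = 1 then 1 else -1)" "t = of_int (if t = 1 then 1 else -1)"
        using \<open>s \<in> {1, -1}\<close> \<open>t \<in> {1, -1}\<close> by auto
    qed auto
    ultimately show thesis
      unfolding NM eval_mat2 by (intro that[of \<sigma> \<tau>]) auto
  qed
  have pq: "0 < int p" "int p < int q" using assms by auto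
  from cases show "N - M \<in> dir_matrix ` directions"
    unfolding of_int_eq_iff
  proof (elim disjE conjE)
    assume "a * int p + (c + 2 * u) * int q = \<sigma> * int p"
      "c * int p + (2 * v - a) * int q = \<tau> * int q"
    from long_short_coordinates[OF pq b st this(2,1)]
    show ?thesis using st unfolding NM mat2_in_dir_matrices_iff by (auto simp flip: of_int_abs)
  next
    assume "a * int p + (c + 2 * u) * int q = \<sigma> * int q"
      "c * int p + (2 * v - a) * int q = \<tau> * int p"
    \<comment> \<open>The previous case with the two rows exchanged and the first one negated.\<close>
    then have "c * int p + (- a + 2 * v) * int q = \<tau> * int p"
      and "(- a) * int p + (- (c + 2 * u)) * int q = (- \<sigma>) * int q"
      by (simp_all add: algebra_simps)
    from long_short_coordinates[OF pq b(2) _ st(2) _ this(2,1)] b st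
    have "- a = 0 \<and> - (c + 2 * u) = - \<sigma> \<and> c = \<tau> \<and> - a + 2 * v = 0" by auto
    then show ?thesis using st unfolding NM mat2_in_dir_matrices_iff by (auto simp flip: of_int_abs)
  qed
qed

section \<open>The pinwheel direction graph\<close>

abbreviation pinwheel_graph :: "nat \<Rightarrow> nat \<Rightarrow> nat \<Rightarrow> (real ^ 2) pair_pre_digraph" where
  "pinwheel_graph p q n \<equiv> leaper_graph p q (pinwheel_board p q n)"

lemma dir_translation_eq_eval: "dir_translation p q i = eval p q (dir_matrix i)"
  by (simp add: dir_translation_def eval_def)

lemma inj_on_dir_translation:
  assumes "0 < p" "p < q"
  shows "inj_on (dir_translation p q) directions"
proof -
  have "0 < real p" "real p < real q" using assms by simp_all
  then show ?thesis
    unfolding inj_on_def directions_eq ball_simps dir_translation_eq_eval dir_matrix_simps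
      eval_mat2 vector_2_eq_iff
    by (intro conjI impI TrueI; (elim conjE; linarith | rule refl))
qed

lemma move_direction_translation:
  assumes "0 < p" "p < q" "i \<in> directions"
  shows "move_direction p q (dir_translation p q i) = i"
  unfolding move_direction_def
  using assms(3) inj_onD[OF inj_on_dir_translation[OF assms(1,2)]] by (intro the_equality) auto

text \<open>The cell of a square; meaningful only for squares of the board, when \<open>0 < p < q\<close>.\<close>

definition cell_of :: "nat \<Rightarrow> nat \<Rightarrow> nat \<Rightarrow> real ^ 2 \<Rightarrow> real ^ 2 ^ 2" where
  "cell_of p q n = the_inv_into (cells n) (eval p q)"

text \<open>
  Every skew leaper with \<open>p < q\<close> yields the same direction graph; the \<open>(1, 2)\<close>-leaper serves as the
  representative.
\<close>

definition pinwheel_direction_graph :: "nat \<Rightarrow> (real ^ 2) labelled_digraph" where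
  "pinwheel_direction_graph n = extracted 1 2 (pinwheel_graph 1 2 n)"

context
  fixes p q n :: nat
  assumes pq: "0 < p" "p < q"
begin

lemma cell_of_eval: "M \<in> cells n \<Longrightarrow> cell_of p q n (eval p q M) = M"
  unfolding cell_of_def by (rule the_inv_into_f_f[OF inj_on_eval_cells[OF pq]])

lemma pverts_pinwheel_graph: "pverts (pinwheel_graph p q n) = eval p q ` cells n"
  using pq by (simp add: leaper_graph_def pinwheel_board_eq)

lemma parcs_pinwheel_graph_iff:
  assumes "M \<in> cells n" "N \<in> cells n"
  shows "(eval p q M, eval p q N) \<in> parcs (pinwheel_graph p q n) \<longleftrightarrow>
    N - M \<in> dir_matrix ` directions"
  using assms pq leaper_move_cells_iff[OF pq assms] by (simp add: leaper_graph_def pinwheel_board_eq)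

lemma parcs_pinwheel_graphE:
  assumes "(x, y) \<in> parcs (pinwheel_graph p q n)"
  obtains M N where "M \<in> cells n" "N \<in> cells n" "x = eval p q M" "y = eval p q N"
    "N - M \<in> dir_matrix ` directions"
proof -
  have "x \<in> eval p q ` cells n" "y \<in> eval p q ` cells n"
    using assms pq by (auto simp: leaper_graph_def pinwheel_board_eq)
  then obtain M N where MN: "M \<in> cells n" "x = eval p q M" "N \<in> cells n" "y = eval p q N"
    by blast
  then show thesis using that assms parcs_pinwheel_graph_iff by blast
qed

lemma pair_sym_digraph_pinwheel: "pair_sym_digraph (pinwheel_graph p q n)"
proof
  fix e assume "e \<in> parcs (pinwheel_graph p q n)"
  then show "fst e \<in> pverts (pinwheel_graph p q n)" "snd e \<in> pverts (pinwheel_graph p q n)"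
    by (auto simp: leaper_graph_def)
next
  show "symmetric (with_proj (pinwheel_graph p q n))"
    unfolding symmetric_def with_proj_simps
  proof (rule symI)
    fix x y assume "(x, y) \<in> parcs (pinwheel_graph p q n)"
    then obtain M N where MN: "M \<in> cells n" "N \<in> cells n" "x = eval p q M" "y = eval p q N"
      and "N - M \<in> dir_matrix ` directions" by (rule parcs_pinwheel_graphE)
    then have "M - N \<in> dir_matrix ` directions"
      using dir_matrices_uminus_iff[of "N - M"] by simp
    with MN show "(y, x) \<in> parcs (pinwheel_graph p q n)"
      by (simp add: parcs_pinwheel_graph_iff)
  qed
qed

lemma potential_cell_of: "potential (extracted p q (pinwheel_graph p q n)) (cell_of p q n)"
  unfolding potential_def extracted_def
proof clarsimp
  fix x y assume "(x, y) \<in> parcs (pinwheel_graph p q n)"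
  then obtain M N where MN: "M \<in> cells n" "N \<in> cells n" "x = eval p q M" "y = eval p q N"
      and "N - M \<in> dir_matrix ` directions" by (rule parcs_pinwheel_graphE)
  then obtain i where i: "i \<in> directions" "N - M = dir_matrix i" by blast
  then have "y - x = dir_translation p q i"
    by (simp add: MN dir_translation_eq_eval eval_diff[symmetric])
  then have "move_direction p q (y - x) = i"
    using move_direction_translation[OF pq i(1)] by simp
  then show "Suc 0 \<le> move_direction p q (y - x) \<and> move_direction p q (y - x) \<le> 8 \<and>
    dir_matrix (move_direction p q (y - x)) = cell_of p q n y - cell_of p q n x"
    using i MN by (simp add: cell_of_eval)
qed

lemma trivial_pinwheel_graph: "trivial_leaper_graph p q (pinwheel_graph p q n)"
proof -
  have "(\<Sum>(a, b)\<leftarrow>c. dir_matrix (move_direction p q (b - a))) =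
      dir_sum (extracted p q (pinwheel_graph p q n)) c" for c
    by (simp add: dir_sum_def extracted_def case_prod_unfold)
  moreover have "dir_sum (extracted p q (pinwheel_graph p q n)) c = 0"
    if "pre_digraph.cycle (with_proj (pinwheel_graph p q n)) c" for c
    using dir_sum_cycle[OF potential_cell_of] that by (simp add: extracted_def)
  ultimately show ?thesis
    unfolding trivial_leaper_graph_def nontrivial_cycle_def by auto
qed

end

lemma pinwheel_direction_graph_simps [simp]:
  "skeleton (pinwheel_direction_graph n) = pinwheel_graph 1 2 n"
  by (simp add: pinwheel_direction_graph_def extracted_def)

lemma same_direction_graph_pinwheel:
  assumes pq: "0 < p" "p < q"
  shows "same_direction_graph (extracted p q (pinwheel_graph p q n)) (pinwheel_direction_graph n)"
proof -
  have 12: "0 < (1::nat)" "(1::nat) < 2" by simp_all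
  let ?G = "pinwheel_graph p q n" and ?H = "pinwheel_graph 1 2 n"
  define g where "g v = eval 1 2 (cell_of p q n v)" for v
  have g: "g (eval p q M) = eval 1 2 M" if "M \<in> cells n" for M
    using that by (simp add: g_def cell_of_eval[OF pq])
  define f where "f = \<lparr>iso_verts = g, iso_arcs = map_prod g g,
    iso_head = (snd :: (real^2) \<times> (real^2) \<Rightarrow> real^2), iso_tail = fst\<rparr>"
  interpret G: pair_sym_digraph ?G by (rule pair_sym_digraph_pinwheel[OF pq])
  have inj: "inj_on g (pverts ?G)"
    unfolding pverts_pinwheel_graph[OF pq]
    using inj_on_eval_cells[OF 12, of n] by (auto simp: inj_on_def g)
  have "inj_on (map_prod g g) (parcs ?G)"
    by (rule inj_on_subset[OF map_prod_inj_on[OF inj inj]]) (auto dest: G.wellformed')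
  then have iso: "pre_digraph.digraph_isomorphism (with_proj ?G) f"
    unfolding pre_digraph.digraph_isomorphism_def
    using inj by (auto simp: f_def G.wf_digraph)
  have "g ` pverts ?G = pverts ?H"
    unfolding pverts_pinwheel_graph[OF pq] pverts_pinwheel_graph[OF 12] image_image
    by (rule image_cong) (simp_all only: g)
  moreover have "map_prod g g ` parcs ?G = parcs ?H"
  proof (intro equalityI subsetI)
    fix e assume "e \<in> map_prod g g ` parcs ?G"
    then obtain x y where "(x, y) \<in> parcs ?G" and e: "e = (g x, g y)" by auto
    then obtain M N where "M \<in> cells n" "N \<in> cells n" "x = eval p q M" "y = eval p q N"
      "N - M \<in> dir_matrix ` directions" by (auto elim: parcs_pinwheel_graphE[OF pq])
    then show "e \<in> parcs ?H" by (simp only: e g parcs_pinwheel_graph_iff[OF 12])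
  next
    fix e assume "e \<in> parcs ?H"
    moreover obtain x y where e: "e = (x, y)" by (cases e)
    ultimately have "(x, y) \<in> parcs ?H" by simp
    then obtain M N where MN: "M \<in> cells n" "N \<in> cells n" and xy: "x = eval 1 2 M" "y = eval 1 2 N"
      and "N - M \<in> dir_matrix ` directions" by (rule parcs_pinwheel_graphE[OF 12])
    then have "(eval p q M, eval p q N) \<in> parcs ?G"
      by (simp only: parcs_pinwheel_graph_iff[OF pq])
    moreover have "e = map_prod g g (eval p q M, eval p q N)"
      by (simp only: map_prod_simp g MN e xy)
    ultimately show "e \<in> map_prod g g ` parcs ?G" by blast
  qed
  ultimately have app: "with_proj ?H = app_iso f (with_proj ?G)"
    by (simp add: app_iso_def f_def with_proj_def)
  have "label (pinwheel_direction_graph n) (iso_arcs f e) = label (extracted p q ?G) e"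
    if e: "e \<in> parcs ?G" for e
  proof -
    obtain x y where xy: "e = (x, y)" by (cases e)
    then obtain M N where MN: "M \<in> cells n" "N \<in> cells n" "x = eval p q M" "y = eval p q N"
      and "N - M \<in> dir_matrix ` directions" using e by (auto elim: parcs_pinwheel_graphE[OF pq])
    then obtain i where i: "i \<in> directions" "N - M = dir_matrix i" by blast
    have "eval p q N - eval p q M = dir_translation p q i"
      "eval 1 2 N - eval 1 2 M = dir_translation 1 2 i"
      by (simp_all only: dir_translation_eq_eval eval_diff[symmetric] i(2))
    then have "move_direction p q (y - x) = i" "move_direction 1 2 (g y - g x) = i"
      using move_direction_translation[OF pq i(1)] move_direction_translation[OF 12 i(1)]
      by (simp_all only: MN g)
    then show ?thesis
      by (simp add: pinwheel_direction_graph_def extracted_def f_def xy)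
  qed
  with iso app show ?thesis
    unfolding same_direction_graph_def by (intro exI[of _ f]) (simp add: extracted_def)
qed

lemma potential_pinwheel: "potential (pinwheel_direction_graph n) (cell_of 1 2 n)"
  unfolding pinwheel_direction_graph_def by (rule potential_cell_of) simp_all

lemma instantiation_of_pinwheel:
  assumes "0 < q"
  shows "instantiation_of p q (pinwheel_graph p q n) (pinwheel_direction_graph n)"
  unfolding instantiation_of_def
proof (intro exI conjI)
  have 12: "0 < (1::nat)" "(1::nat) < 2" by simp_all
  let ?\<tau> = "\<lambda>v. eval p q (cell_of 1 2 n v)"
  show "?\<tau> ` pverts (skeleton (pinwheel_direction_graph n)) \<subseteq> pverts (pinwheel_graph p q n)"
    unfolding pinwheel_direction_graph_simps pverts_pinwheel_graph[OF 12]
    using assms by (auto simp: cell_of_eval[OF 12] leaper_graph_def pinwheel_board_eq simp del: One_nat_def)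
  show "\<forall>(x, y) \<in> parcs (skeleton (pinwheel_direction_graph n)).
      ?\<tau> y = ?\<tau> x + dir_translation p q (label (pinwheel_direction_graph n) (x, y))"
    using potential_pinwheel[of n]
    by (auto simp: potential_def dir_translation_eq_eval eval_diff)
qed

section \<open>Connectedness\<close>

text \<open>
  From the cell at \<open>(s, d)\<close> there are moves to \<open>(d, - s)\<close> and \<open>(d - 1, 1 - s)\<close> in the next quarter
  and to \<open>(- d, s)\<close> in the previous one, as far as these positions belong to the quarter.
\<close>

lemma cell_step_forward:
  assumes "e \<in> {1, -1}" "f \<in> {1, -1}"
  shows "cell (- f) e d (- s) - cell e f s d \<in> dir_matrix ` directions"
  using assms unfolding cell_def mat2_diff mat2_in_dir_matrices_iff by (auto simp: field_simps)

lemma cell_step_forward_shift: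
  assumes "e \<in> {1, -1}" "f \<in> {1, -1}"
  shows "cell (- f) e (d - 1) (1 - s) - cell e f s d \<in> dir_matrix ` directions"
  using assms unfolding cell_def mat2_diff mat2_in_dir_matrices_iff by (auto simp: field_simps)

lemma cell_step_backward:
  assumes "e \<in> {1, -1}" "f \<in> {1, -1}"
  shows "cell f (- e) (- d) s - cell e f s d \<in> dir_matrix ` directions"
  using assms unfolding cell_def mat2_diff mat2_in_dir_matrices_iff by (auto simp: field_simps)

text \<open>
  Combining a move to a neighbouring quarter with one back, \<open>s\<close> can be lowered while \<open>d\<close> changes by
  one towards \<open>1 / 2\<close>. A position with \<open>s = 0\<close> other than \<open>(0, 0)\<close> can be exchanged with one in a
  neighbouring quarter for which \<open>s + \<bar>2 d - 1\<bar>\<close> is smaller. Thus every cell is joined to the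
  position \<open>(0, 0)\<close> of some quarter, and these four cells form a cycle.
\<close>

lemma reachable_root:
  assumes "0 < n" "e \<in> {1, -1}" "f \<in> {1, -1}" "in_quarter n s d"
  shows "reachable (with_proj (pinwheel_graph 1 2 n)) (eval 1 2 (cell e f s d)) (eval 1 2 (cell 1 1 0 0))"
proof -
  have 12: "0 < (1::nat)" "(1::nat) < 2" by simp_all
  interpret pair_sym_digraph "pinwheel_graph 1 2 n" by (rule pair_sym_digraph_pinwheel[OF 12])
  define R where "R M N \<longleftrightarrow> reachable (with_proj (pinwheel_graph 1 2 n)) (eval 1 2 M) (eval 1 2 N)" for M N
  have trans: "R M N \<Longrightarrow> R N K \<Longrightarrow> R M K" for M N K
    unfolding R_def by (rule reachable_trans)
  have step: "R M N" if "M \<in> cells n" "N \<in> cells n" "N - M \<in> dir_matrix ` directions" for M N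
    unfolding R_def using that by (intro reachable_adjI) (simp only: parcs_pinwheel_graph_iff[OF 12])
  have turn1: "R (cell e f s d) (cell (-f) e d (-s))"
    if "e \<in> {1, -1}" "f \<in> {1, -1}" "in_quarter n s d" "0 \<le> d" "s < int n" for e f s d
    using that
    by (intro step cell_in_cells cell_step_forward) (auto simp: in_quarter_def)
  have turn2: "R (cell e f s d) (cell (-f) e (d - 1) (1 - s))"
    if "e \<in> {1, -1}" "f \<in> {1, -1}" "in_quarter n s d" "1 \<le> d" for e f s d
    using that
    by (intro step cell_in_cells cell_step_forward_shift) (auto simp: in_quarter_def)
  have turn3: "R (cell e f s d) (cell f (-e) (-d) s)"
    if "e \<in> {1, -1}" "f \<in> {1, -1}" "in_quarter n s d" "d \<le> 0" for e f s d
    using that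
    by (intro step cell_in_cells cell_step_backward) (auto simp: in_quarter_def)
  have "R (cell e f s d) (cell 1 1 0 0)"
    using assms(2-4)
  proof (induction "nat (s + \<bar>2 * d - 1\<bar>)" arbitrary: e f s d rule: less_induct)
    case less
    note ef = less.prems(1,2) and sd = less.prems(3)
    have ef': "- e \<in> {1, -1}" "- f \<in> {1, -1}" using ef by auto
    note bounds = sd[unfolded in_quarter_def]
    \<comment> \<open>\<open>(0, 1)\<close> is not a position, by parity.\<close>
    consider "s = 0" "d = 0" | "s = 0" "2 \<le> d" | "s = 0" "d < 0" | "1 \<le> s" "1 \<le> d" | "1 \<le> s" "d \<le> 0"
    proof -
      have "s \<noteq> 0 \<or> d \<noteq> 1" using bounds by auto
      with bounds that show thesis by linarith
    qed
    then show ?case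
    proof cases
      case 1
      have q0: "in_quarter n 0 0" using assms(1) by (simp add: in_quarter_def)
      have turn: "R (cell e f 0 0) (cell (- f) e 0 0)" if "e \<in> {1, -1}" "f \<in> {1, -1}" for e f
        using turn1[OF that q0] assms(1) by simp
      have "R (cell 1 (-1) 0 0) (cell 1 1 0 0)" using turn[of 1 "-1"] by simp
      moreover from this have "R (cell (-1) (-1) 0 0) (cell 1 1 0 0)"
        using turn[of "-1" "-1"] by (auto intro: trans)
      moreover from this have "R (cell (-1) 1 0 0) (cell 1 1 0 0)"
        using turn[of "-1" 1] by (auto intro: trans)
      moreover have "R (cell 1 1 0 0) (cell 1 1 0 0)"
        unfolding R_def using q0
        by (intro reachable_refl) (auto simp only: pverts_pinwheel_graph[OF 12] intro!: imageI cell_in_cells)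
      ultimately show ?thesis using ef 1 by auto
    next
      case low: 2
      have "in_quarter n (d - 1) (1 - s)" using bounds low by (auto simp: in_quarter_def)
      then have "R (cell (-f) e (d - 1) (1 - s)) (cell 1 1 0 0)"
        using ef ef' low by (intro less.hyps) auto
      with turn2[OF ef sd] low show ?thesis by (auto intro: trans)
    next
      case neg: 3
      have "in_quarter n (- d) s" using bounds neg by (auto simp: in_quarter_def)
      then have "R (cell f (-e) (-d) s) (cell 1 1 0 0)"
        using ef ef' neg by (intro less.hyps) auto
      with turn3[OF ef sd] neg show ?thesis by (auto intro: trans)
    next
      case 4
      have a: "in_quarter n (d - 1) (1 - s)" and b: "in_quarter n (s - 1) (d - 1)"
        using bounds 4 by (auto simp: in_quarter_def)
      have "R (cell e f s d) (cell (-f) e (d - 1) (1 - s))" using turn2[OF ef sd] 4 by simp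
      moreover have "R (cell (-f) e (d - 1) (1 - s)) (cell e f (s - 1) (d - 1))"
        using turn3[OF ef'(2) ef(1) a] 4 by simp
      moreover have "R (cell e f (s - 1) (d - 1)) (cell 1 1 0 0)"
        using ef b 4 by (intro less.hyps) auto
      ultimately show ?thesis by (blast intro: trans)
    next
      case 5
      have a: "in_quarter n (- d) s" and b: "in_quarter n (s - 1) (d + 1)"
        using bounds 5 by (auto simp: in_quarter_def)
      have "R (cell e f s d) (cell f (-e) (-d) s)" using turn3[OF ef sd] 5 by simp
      moreover have "R (cell f (-e) (-d) s) (cell e f (s - 1) (d + 1))"
        using turn2[OF ef(2) ef'(1) a] 5 by (simp add: add.commute)
      moreover have "R (cell e f (s - 1) (d + 1)) (cell 1 1 0 0)"
        using ef b 5 by (intro less.hyps) auto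
      ultimately show ?thesis by (blast intro: trans)
    qed
  qed
  then show ?thesis unfolding R_def .
qed

section \<open>Duality\<close>

lemma connected_pinwheel:
  assumes "0 < n"
  shows "Digraph_Component.connected (with_proj (pinwheel_graph 1 2 n))"
proof -
  have 12: "0 < (1::nat)" "(1::nat) < 2" by simp_all
  interpret pair_sym_digraph "pinwheel_graph 1 2 n" by (rule pair_sym_digraph_pinwheel[OF 12])
  let ?r = "eval 1 2 (cell 1 1 0 0)"
  have "in_quarter n 0 0" using assms by (simp add: in_quarter_def)
  then have "cell 1 1 0 0 \<in> cells n" by (intro cell_in_cells) auto
  then have ne: "pverts (pinwheel_graph 1 2 n) \<noteq> {}"
    unfolding pverts_pinwheel_graph[OF 12] by blast
  have root: "reachable (with_proj (pinwheel_graph 1 2 n)) x ?r"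
    if "x \<in> pverts (pinwheel_graph 1 2 n)" for x
    using that reachable_root[OF assms] unfolding pverts_pinwheel_graph[OF 12] cells_def by blast
  have "reachable (with_proj (pinwheel_graph 1 2 n)) x y"
    if "x \<in> pverts (pinwheel_graph 1 2 n)" "y \<in> pverts (pinwheel_graph 1 2 n)" for x y
    using root[OF that(1)] symmetric_reachable'[OF root[OF that(2)]] by (rule reachable_trans)
  with ne show ?thesis
    unfolding connected_def strongly_connected_def reachable_mk_symmetric_eq[OF sym_arcs]
    by (simp add: mk_symmetric_def)
qed

lemma reachable_pinwheel:
  assumes "0 < n" "x \<in> pverts (pinwheel_graph 1 2 n)" "y \<in> pverts (pinwheel_graph 1 2 n)"
  shows "reachable (with_proj (pinwheel_graph 1 2 n)) x y"
proof -
  have 12: "0 < (1::nat)" "(1::nat) < 2" by simp_all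
  interpret pair_sym_digraph "pinwheel_graph 1 2 n" by (rule pair_sym_digraph_pinwheel[OF 12])
  show ?thesis
    using connected_pinwheel[OF assms(1)] assms(2,3)
    unfolding connected_def strongly_connected_def reachable_mk_symmetric_eq[OF sym_arcs]
    by (simp add: mk_symmetric_def)
qed

text \<open>The matrix that induces \<open>pinwheel_perm\<close> by multiplication from the right.\<close>

abbreviation pinwheel_right :: "real ^ 2 ^ 2" where
  "pinwheel_right \<equiv> mat2 0 1 (-1) 0"

text \<open>The matrix that induces \<open>reflect_perm\<close> by multiplication from the left.\<close>

abbreviation reflect_left :: "real ^ 2 ^ 2" where
  "reflect_left \<equiv> mat2 1 0 0 (-1)"

lemma pinwheel_perm_directions:
  assumes "i \<in> directions"
  shows "pinwheel_perm i \<in> directions"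
    and "dir_matrix (pinwheel_perm i) = dir_matrix i ** pinwheel_right"
  using assms unfolding directions_eq
  by (auto simp: pinwheel_perm_def dir_matrix_def mat2_mult mat2_uminus)

lemma reflect_perm_directions:
  assumes "i \<in> directions"
  shows "reflect_perm i \<in> directions" and "dir_matrix (reflect_perm i) = reflect_left ** dir_matrix i"
  using assms unfolding directions_eq
  by (auto simp: reflect_perm_def dir_matrix_def mat2_mult mat2_uminus)

lemma equivalence_permutation_pinwheel:
  "equivalence_permutation pinwheel_perm (mat 1) pinwheel_right"
  unfolding equivalence_permutation_def
proof
  have "inj_on pinwheel_perm directions"
    unfolding directions_eq by (simp add: pinwheel_perm_def)
  moreover have "pinwheel_perm ` directions \<subseteq> directions"
    using pinwheel_perm_directions(1) by blast
  ultimately have "bij_betw pinwheel_perm directions directions"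
    by (simp add: bij_betw_def endo_inj_surj)
  then show "pinwheel_perm permutes directions"
    by (rule bij_imp_permutes) (simp only: pinwheel_perm_def if_False)
  show "\<forall>i\<in>directions. dir_matrix (pinwheel_perm i) = mat 1 ** dir_matrix i ** pinwheel_right"
    using pinwheel_perm_directions(2) by simp
qed

text \<open>
  The relabelling that yields the complement, and its left factor; the right factor is
  \<open>pinwheel_right\<close> for both parities.
\<close>

definition dual_perm :: "nat \<Rightarrow> nat \<Rightarrow> nat" where
  "dual_perm n = (if odd n then pinwheel_perm else reflect_perm \<circ> pinwheel_perm)"

definition dual_left :: "nat \<Rightarrow> real ^ 2 ^ 2" where
  "dual_left n = (if odd n then mat 1 else reflect_left)"

text \<open>
  The mapping between the vertices, on cells. Its right factor is the product of \<open>pinwheel_right\<close>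
  and the duality matrix.
\<close>

definition dual_map :: "nat \<Rightarrow> real ^ 2 ^ 2 \<Rightarrow> real ^ 2 ^ 2" where
  "dual_map n M = dual_left n ** M ** mat2 1 (2 * real n) 0 (-1)"

lemma dual_perm_directions:
  assumes "i \<in> directions"
  shows "dual_perm n i \<in> directions"
    and "dir_matrix (dual_perm n i) = dual_left n ** dir_matrix i ** pinwheel_right"
  using pinwheel_perm_directions[OF assms] reflect_perm_directions[OF pinwheel_perm_directions(1)[OF assms]]
  by (auto simp: dual_perm_def dual_left_def matrix_mul_assoc)

lemma dual_left_mat2: "dual_left n ** mat2 a b c d = (if odd n then mat2 a b c d else mat2 a b (- c) (- d))"
  by (simp add: dual_left_def mat2_mult)

lemma sandwich_in_dir_matrices_iff:
  "dual_left n ** M ** pinwheel_right \<in> dir_matrix ` directions \<longleftrightarrow> M \<in> dir_matrix ` directions"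
proof (cases M rule: mat2_cases)
  case (1 a b c d)
  then show ?thesis
    by (simp only: dual_left_mat2 mat2_mult mat2_in_dir_matrices_iff split: if_split) auto
qed

lemma inj_sandwich: "inj (\<lambda>M. dual_left n ** M ** pinwheel_right)"
proof (rule injI)
  fix M N assume *: "dual_left n ** M ** pinwheel_right = dual_left n ** N ** pinwheel_right"
  show "M = N"
    using * by (cases M rule: mat2_cases; cases N rule: mat2_cases)
      (auto simp: dual_left_mat2 mat2_mult split: if_splits)
qed

lemma dual_map_dual_map: "dual_map n (dual_map n M) = M"
  by (cases M rule: mat2_cases) (simp add: dual_map_def dual_left_mat2 mat2_mult)

text \<open>
  Negating the second column would take \<open>(s, d)\<close> to \<open>(- s, 1 - d)\<close>; adding \<open>2 n\<close> times the first
  column shifts \<open>- s\<close> to \<open>n - s\<close>. For even \<open>n\<close> this has the wrong parity, and the reflection, which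
  is a conjugation of the complex numbers in the columns, turns \<open>1 - d\<close> back into \<open>d\<close>.
\<close>

lemma dual_map_cell:
  "dual_map n (cell e f s d) =
     (if odd n then cell e f (int n - s) (1 - d) else cell e (- f) (int n - s) d)"
  by (simp add: dual_map_def dual_left_mat2 cell_def mat2_mult algebra_simps)

lemma dual_map_cells:
  assumes "M \<in> cells n"
  shows "dual_map n M \<in> cells n"
proof -
  obtain e f s d where M: "M = cell e f s d" and ef: "e \<in> {1, -1}" "f \<in> {1, -1}" and
    "in_quarter n s d"
    using assms unfolding cells_def by blast
  then have "if odd n then in_quarter n (int n - s) (1 - d) else in_quarter n (int n - s) d"
    by (auto simp: in_quarter_def)
  moreover have "- f \<in> {1, -1}" using ef by auto
  ultimately show ?thesis
    unfolding M dual_map_cell using ef by (simp add: cell_in_cells split: if_splits)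
qed

lemma dual_via_pinwheel:
  assumes "0 < n"
  shows "dual_via (pinwheel_direction_graph n) (permute_labels (dual_perm n) (pinwheel_direction_graph n))
    (mat2 0 1 1 (2 * real n))"
proof -
  have 12: "0 < (1::nat)" "(1::nat) < 2" by simp_all
  let ?G = "pinwheel_graph 1 2 n" and ?W = "pinwheel_direction_graph n"
  let ?W' = "permute_labels (dual_perm n) (pinwheel_direction_graph n)"
  let ?\<phi> = "cell_of 1 2 n"
  let ?\<phi>' = "\<lambda>v. dual_left n ** ?\<phi> v ** pinwheel_right"
  have sym: "pair_sym_digraph ?G" by (rule pair_sym_digraph_pinwheel[OF 12])
  interpret pair_sym_digraph ?G by (rule sym)
  have skel [simp]: "skeleton ?W' = ?G" by (simp add: permute_labels_def)
  have pot: "potential ?W ?\<phi>" by (rule potential_pinwheel)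
  have pot': "potential ?W' ?\<phi>'"
    unfolding potential_def skel
  proof (intro ballI, clarify)
    fix x y assume "(x, y) \<in> parcs ?G"
    then have l: "label ?W (x, y) \<in> directions" "dir_matrix (label ?W (x, y)) = ?\<phi> y - ?\<phi> x"
      using pot by (auto simp: potential_def)
    then show "label ?W' (x, y) \<in> directions \<and> dir_matrix (label ?W' (x, y)) = ?\<phi>' y - ?\<phi>' x"
      using dual_perm_directions[OF l(1), of n] by (simp add: permute_labels_def matrix_diff_sandwich)
  qed
  have inj: "inj_on ?\<phi> (pverts ?G)"
    unfolding pverts_pinwheel_graph[OF 12] by (auto simp: inj_on_def cell_of_eval[OF 12] simp del: One_nat_def)
  have inj': "inj_on ?\<phi>' (pverts ?G)"
    using inj inj_sandwich[of n] by (auto simp: inj_on_def)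
  have arcs: "?\<phi> y - ?\<phi> x \<in> dir_matrix ` directions \<longleftrightarrow> (x, y) \<in> parcs ?G"
    if xy: "x \<in> pverts ?G" "y \<in> pverts ?G" for x y
  proof -
    obtain M N where "M \<in> cells n" "N \<in> cells n" "x = eval 1 2 M" "y = eval 1 2 N"
      using xy unfolding pverts_pinwheel_graph[OF 12] by blast
    then show ?thesis by (simp only: cell_of_eval[OF 12] parcs_pinwheel_graph_iff[OF 12])
  qed
  have "?\<phi>' y - ?\<phi>' x \<in> dir_matrix ` directions \<longleftrightarrow> (x, y) \<in> parcs ?G"
    if "x \<in> pverts ?G" "y \<in> pverts ?G" for x y
    unfolding matrix_diff_sandwich[symmetric] sandwich_in_dir_matrices_iff using that by (rule arcs)
  then have coh': "coherent ?W'"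
    by (intro coherent_of_potential[OF _ pot']) (simp_all only: skel sym inj')
  have coh: "coherent ?W"
    by (intro coherent_of_potential[OF _ pot]) (simp_all only: pinwheel_direction_graph_simps sym inj arcs)
  have iso: "digraph_iso (with_proj ?G) (with_proj ?G)"
    unfolding digraph_iso_def pre_digraph.digraph_isomorphism_def app_iso_def
    by (intro exI[of _ "\<lparr>iso_verts = id, iso_arcs = id, iso_head = snd, iso_tail = fst\<rparr>"])
      (simp add: with_proj_def wf_digraph[unfolded with_proj_def] del: One_nat_def)
  define \<eta> where "\<eta> v = eval 1 2 (dual_map n (?\<phi> v))" for v
  have \<eta>: "\<eta> (eval 1 2 M) = eval 1 2 (dual_map n M)" if "M \<in> cells n" for M
    unfolding \<eta>_def cell_of_eval[OF 12 that] ..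
  have \<eta>_verts: "\<eta> v \<in> pverts ?G" and \<eta>_\<eta>: "\<eta> (\<eta> v) = v" if "v \<in> pverts ?G" for v
  proof -
    obtain M where M: "M \<in> cells n" "v = eval 1 2 M"
      using \<open>v \<in> pverts ?G\<close> unfolding pverts_pinwheel_graph[OF 12] by blast
    show "\<eta> v \<in> pverts ?G" "\<eta> (\<eta> v) = v"
      unfolding M(2) \<eta>[OF M(1)] \<eta>[OF dual_map_cells[OF M(1)]] dual_map_dual_map
        pverts_pinwheel_graph[OF 12] using dual_map_cells[OF M(1)] by blast+
  qed
  have bij: "bij_betw \<eta> (pverts ?G) (pverts ?G)"
    by (rule bij_betw_byWitness[where f' = \<eta>]) (auto simp: \<eta>_verts \<eta>_\<eta> simp del: One_nat_def)
  have dist: "distance ?W a b = dir_matrix (label ?W' (\<eta> a, \<eta> b)) ** mat2 0 1 1 (2 * real n)"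
    if ab: "a \<in> pverts ?G" "b \<in> pverts ?G" and arc: "(\<eta> a, \<eta> b) \<in> parcs ?G" for a b
  proof -
    have l: "label ?W (\<eta> a, \<eta> b) \<in> directions"
      "dir_matrix (label ?W (\<eta> a, \<eta> b)) = ?\<phi> (\<eta> b) - ?\<phi> (\<eta> a)"
      using pot arc by (auto simp: potential_def)
    have \<phi>\<eta>: "dual_map n (?\<phi> (\<eta> v)) = ?\<phi> v" if v: "v \<in> pverts ?G" for v
    proof -
      obtain M where M: "M \<in> cells n" "v = eval 1 2 M"
        using v unfolding pverts_pinwheel_graph[OF 12] by blast
      show ?thesis
        unfolding M(2) \<eta>[OF M(1)] cell_of_eval[OF 12 M(1)]
          cell_of_eval[OF 12 dual_map_cells[OF M(1)]] by (rule dual_map_dual_map)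
    qed
    have "pinwheel_right ** mat2 0 1 1 (2 * real n) = mat2 1 (2 * real n) 0 (-1)"
      by (simp add: mat2_mult)
    then have "dir_matrix (label ?W' (\<eta> a, \<eta> b)) ** mat2 0 1 1 (2 * real n) =
        dual_left n ** dir_matrix (label ?W (\<eta> a, \<eta> b)) ** mat2 1 (2 * real n) 0 (-1)"
      using dual_perm_directions(2)[OF l(1), of n]
      by (simp add: permute_labels_def matrix_mul_assoc[symmetric])
    also have "\<dots> = dual_map n (?\<phi> (\<eta> b)) - dual_map n (?\<phi> (\<eta> a))"
      unfolding l(2) dual_map_def matrix_diff_sandwich ..
    also have "\<dots> = ?\<phi> b - ?\<phi> a"
      unfolding \<phi>\<eta>[OF ab(1)] \<phi>\<eta>[OF ab(2)] ..
    also have "\<dots> = distance ?W a b"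
      using distance_of_potential[OF _ pot] sym reachable_pinwheel[OF assms ab] by simp
    finally show ?thesis ..
  qed
  have "mat2 0 1 1 (2 * real n) \<notin> dir_matrix ` directions"
    unfolding mat2_in_dir_matrices_iff using assms by simp
  moreover have "direction_graph ?W" "direction_graph ?W'"
    using direction_graph_of_potential[OF _ pot] direction_graph_of_potential[OF _ pot'] sym by simp_all
  moreover have "\<exists>\<eta>. bij_betw \<eta> (pverts ?G) (pverts ?G) \<and>
      (\<forall>a \<in> pverts ?G. \<forall>b \<in> pverts ?G. (\<eta> a, \<eta> b) \<in> parcs ?G \<longrightarrow>
         distance ?W a b = dir_matrix (label ?W' (\<eta> a, \<eta> b)) ** mat2 0 1 1 (2 * real n))"
    using bij dist by blast
  ultimately show ?thesis
    unfolding dual_via_def skel pinwheel_direction_graph_simps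
    using coh coh' connected_pinwheel[OF assms] iso by blast
qed

theorem theorem24:
  fixes n :: nat
  assumes "0 < n"
  shows "equivalence_permutation pinwheel_perm (mat 1) (mat2 0 1 (-1) 0) \<and>
    (\<exists>W :: (real ^ 2) labelled_digraph.
       direction_graph W \<and>
       (\<forall>p q. skew p q \<and> p < q \<longrightarrow>
          trivial_leaper_graph p q (leaper_graph p q (pinwheel_board p q n)) \<and>
          same_direction_graph (extracted p q (leaper_graph p q (pinwheel_board p q n))) W) \<and>
       (\<forall>p q. \<not> skew p q \<and> p < q \<longrightarrow>
          instantiation_of p q (leaper_graph p q (pinwheel_board p q n)) W) \<and>
       dual_via W
         (if odd n then permute_labels pinwheel_perm W
          else permute_labels (reflect_perm \<circ> pinwheel_perm) W)
         (mat2 0 1 1 (2 * real n)))"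
proof (intro conjI exI[of _ "pinwheel_direction_graph n"] allI impI)
  show "equivalence_permutation pinwheel_perm (mat 1) (mat2 0 1 (-1) 0)"
    by (rule equivalence_permutation_pinwheel)
  show "direction_graph (pinwheel_direction_graph n)"
    using dual_via_pinwheel[OF assms] by (simp add: dual_via_def)
  show "dual_via (pinwheel_direction_graph n)
     (if odd n then permute_labels pinwheel_perm (pinwheel_direction_graph n)
      else permute_labels (reflect_perm \<circ> pinwheel_perm) (pinwheel_direction_graph n))
     (mat2 0 1 1 (2 * real n))"
    using dual_via_pinwheel[OF assms] by (simp add: dual_perm_def split: if_splits)
next
  fix p q assume "skew p q \<and> p < q"
  then have pq: "0 < p" "p < q" by (auto simp: skew_def)
  show "trivial_leaper_graph p q (pinwheel_graph p q n)"
    by (rule trivial_pinwheel_graph[OF pq])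
  show "same_direction_graph (extracted p q (pinwheel_graph p q n)) (pinwheel_direction_graph n)"
    by (rule same_direction_graph_pinwheel[OF pq])
next
  fix p q assume "\<not> skew p q \<and> p < q"
  then show "instantiation_of p q (pinwheel_graph p q n) (pinwheel_direction_graph n)"
    by (intro instantiation_of_pinwheel) auto
qed

end
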